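(* Let $k,d\in\mathbb{N}$ and $m^{(d)}=(m_1,\ldots,m_d)\in\mathbb{N}^d$. Let $f_d$ (resp. $g_d$) denote the total number of descents and cyclic descents (resp. levels and cyclic levels) of all $m^{(d)}$-tensor words over $[k]$, i.e., $f_d=\sum_{w\in T(m^{(d)},k)}\mathrm{cycdes}(w)$ and $g_d=\sum_{w\in T(m^{(d)},k)}\mathrm{cyclev}(w)$. Then $$f_d=\frac{1}{2}\left(d\prod_{\ell\in[d]}m_{\ell}\right)(k-1)k^{\prod_{\ell\in[d]}m_{\ell}-1}$$ and $g_d=2f_d/(k-1)$, i.e., $$g_d=\left(d\prod_{\ell\in[d]}m_{\ell}\right)k^{\prod_{\ell\in[d]}m_{\ell}-1}.$$
   Context: $\mathbb{N}$ is the set of natural numbers $\{1,2,\ldots\}$ and $[n]=\{1,\ldots,n\}$. For $m^{(d)}=(m_1,\ldots,m_d)\in\mathbb{N}^d$, an $m^{(d)}$-tensor word over $[k]$ is a function $w\colon[m_1]\times\cdots\times[m_d]\to[k]$; $T(m^{(d)},k)$ denotes the set of all of them. With $e_\ell$ the $\ell$th standard basis vector of $\mathbb{R}^d$, a descent (resp. level) of $w$ is a pair $(i,j)\in([m_1]\times\cdots\times[m_d])^2$ such that $w(i)>w(j)$ (resp. $w(i)=w(j)$) and $j=i+e_\ell$ for some $\ell\in[d]$. A cyclic descent (resp. cyclic level) of $w$ is a pair $(i,j)\in([m_1]\times\cdots\times[m_d])^2$ such that $w(i)>w(j)$ (resp. $w(i)=w(j)$) and there exists a unique $\ell\in[d]$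 with $i_\ell=m_\ell$, $j_\ell=1$, and $i_r=j_r$ for all $r\in[d]\setminus\{\ell\}$. $\mathrm{cycdes}(w)$ (resp. $\mathrm{cyclev}(w)$) denotes the number of descents and cyclic descents (resp. levels and cyclic levels) of $w$.
   Formalization: All m_ℓ are assumed to be at least 2, since the formulas fail when some m_ℓ=1 (for d=1, m_1=1, k=2 one has f_d=0, not 1/2, and g_d=2, not 1); the relation g_d=2f_d/(k-1) is stated only for k≠1, as it is 0/0 at k=1. *)

theory Defs
  imports Complex_Main "HOL-Library.FuncSet"
begin

text \<open>
  A tuple in \<open>[m\<^sub>1] \<times> \<dots> \<times> [m\<^sub>d]\<close> is an extensional function on \<open>{1..d}\<close>, and a tensor word is an
  extensional function on the set of these tuples, so that both sets are finite and function
  equality is equality of tuples, respectively of words.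

  Nothing below excludes a side length \<open>m l = 1\<close>, but then the total counts are not the stated
  closed forms: the cyclic successor in such a direction is the tuple itself, which never gives a
  descent (for \<open>d = 1\<close>, \<open>m 1 = 1\<close>, \<open>k = 2\<close> the totals are 0 descents and 2 levels, not 1/2 and 1).
  Hence the theorem assumes \<open>m l \<ge> 2\<close>.
\<close>

definition index_box :: "nat \<Rightarrow> (nat \<Rightarrow> nat) \<Rightarrow> (nat \<Rightarrow> nat) set" where
  "index_box d m = (\<Pi>\<^sub>E l\<in>{1..d}. {1..m l})"

definition tensor_words :: "nat \<Rightarrow> (nat \<Rightarrow> nat) \<Rightarrow> nat \<Rightarrow> ((nat \<Rightarrow> nat) \<Rightarrow> nat) set" where
  "tensor_words d m k = index_box d m \<rightarrow>\<^sub>E {1..k}"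

text \<open>\<open>successor d i j\<close>: \<open>j = i + e\<^sub>l\<close> for some \<open>l \<in> [d]\<close>.\<close>

definition successor :: "nat \<Rightarrow> (nat \<Rightarrow> nat) \<Rightarrow> (nat \<Rightarrow> nat) \<Rightarrow> bool" where
  "successor d i j \<longleftrightarrow>
     (\<exists>l\<in>{1..d}. \<forall>r\<in>{1..d}. j r = i r + (if r = l then 1 else 0))"

definition cyclic_successor ::
    "nat \<Rightarrow> (nat \<Rightarrow> nat) \<Rightarrow> (nat \<Rightarrow> nat) \<Rightarrow> (nat \<Rightarrow> nat) \<Rightarrow> bool" where
  "cyclic_successor d m i j \<longleftrightarrow>
     (\<exists>!l. l \<in> {1..d} \<and> i l = m l \<and> j l = 1 \<and> (\<forall>r\<in>{1..d} - {l}. i r = j r))"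

definition descents ::
    "nat \<Rightarrow> (nat \<Rightarrow> nat) \<Rightarrow> ((nat \<Rightarrow> nat) \<Rightarrow> nat) \<Rightarrow> ((nat \<Rightarrow> nat) \<times> (nat \<Rightarrow> nat)) set" where
  "descents d m w = {(i, j) \<in> index_box d m \<times> index_box d m. w i > w j \<and> successor d i j}"

definition levels ::
    "nat \<Rightarrow> (nat \<Rightarrow> nat) \<Rightarrow> ((nat \<Rightarrow> nat) \<Rightarrow> nat) \<Rightarrow> ((nat \<Rightarrow> nat) \<times> (nat \<Rightarrow> nat)) set" where
  "levels d m w = {(i, j) \<in> index_box d m \<times> index_box d m. w i = w j \<and> successor d i j}"

definition cyclic_descents ::
    "nat \<Rightarrow> (nat \<Rightarrow> nat) \<Rightarrow> ((nat \<Rightarrow> nat) \<Rightarrow> nat) \<Rightarrow> ((nat \<Rightarrow> nat) \<times> (nat \<Rightarrow> nat)) set" where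
  "cyclic_descents d m w =
     {(i, j) \<in> index_box d m \<times> index_box d m. w i > w j \<and> cyclic_successor d m i j}"

definition cyclic_levels ::
    "nat \<Rightarrow> (nat \<Rightarrow> nat) \<Rightarrow> ((nat \<Rightarrow> nat) \<Rightarrow> nat) \<Rightarrow> ((nat \<Rightarrow> nat) \<times> (nat \<Rightarrow> nat)) set" where
  "cyclic_levels d m w =
     {(i, j) \<in> index_box d m \<times> index_box d m. w i = w j \<and> cyclic_successor d m i j}"

definition cycdes :: "nat \<Rightarrow> (nat \<Rightarrow> nat) \<Rightarrow> ((nat \<Rightarrow> nat) \<Rightarrow> nat) \<Rightarrow> nat" where
  "cycdes d m w = card (descents d m w) + card (cyclic_descents d m w)"

definition cyclev :: "nat \<Rightarrow> (nat \<Rightarrow> nat) \<Rightarrow> ((nat \<Rightarrow> nat) \<Rightarrow> nat) \<Rightarrow> nat" where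
  "cyclev d m w = card (levels d m w) + card (cyclic_levels d m w)"

definition total_cycdes :: "nat \<Rightarrow> (nat \<Rightarrow> nat) \<Rightarrow> nat \<Rightarrow> nat" where
  "total_cycdes d m k = (\<Sum>w\<in>tensor_words d m k. cycdes d m w)"

definition total_cyclev :: "nat \<Rightarrow> (nat \<Rightarrow> nat) \<Rightarrow> nat \<Rightarrow> nat" where
  "total_cyclev d m k = (\<Sum>w\<in>tensor_words d m k. cyclev d m w)"

end

theory Submission
  imports Defs
begin

text \<open>
  Moving one step in direction \<open>l\<close>, with wrap-around from \<open>m l\<close> to \<open>1\<close>, turns the box into a
  discrete torus. Since all side lengths are at least \<open>2\<close>, the neighbour reached from a cell is
  a different cell, it determines the direction \<open>l\<close>, and it is never reached both as an ordinary
  and as a cyclic successor. So the pairs examined by \<open>cycdes\<close> and \<open>cyclev\<close> correspond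
  to the \<open>d * N\<close> choices of a cell and a direction, where \<open>N\<close> is the number of cells
  (\<open>card_torus_edges\<close>).

  Now exchange the two summations: instead of counting the descents of each word, count for each
  pair of distinct cells \<open>i\<close>, \<open>j\<close> the words with \<open>w i > w j\<close>. A word with \<open>w i = w j\<close> is
  determined by its values off \<open>j\<close>, so there are \<open>k ^ (N - 1)\<close> of them (\<open>card_words_level\<close>); swapping
  the letters at \<open>i\<close> and \<open>j\<close> shows that the remaining words split evenly into \<open>w i > w j\<close> and
  \<open>w i < w j\<close> (\<open>card_words_descent\<close>). Neither number depends on the pair, so both totals are
  the number of pairs times the count for a single pair.
\<close>

section \<open>Words compared at two positions\<close>

text \<open>Such a word is the same thing as a word on the positions other than \<open>j\<close>: the letter at
  \<open>j\<close> is copied from \<open>i\<close>.\<close>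

lemma card_words_level:
  fixes B :: "'a set" and K :: "'b set"
  assumes "finite B" "i \<in> B" "j \<in> B" "i \<noteq> j"
  shows "card {w \<in> B \<rightarrow>\<^sub>E K. w i = w j} = card K ^ (card B - 1)"
proof -
  have "bij_betw (\<lambda>w. restrict w (B - {j})) {w \<in> B \<rightarrow>\<^sub>E K. w i = w j} ((B - {j}) \<rightarrow>\<^sub>E K)"
  proof (rule bij_betw_byWitness[where f' = "\<lambda>v. v(j := v i)"])
    show "\<forall>w\<in>{w \<in> B \<rightarrow>\<^sub>E K. w i = w j}.
        (restrict w (B - {j}))(j := restrict w (B - {j}) i) = w"
      using assms by (auto simp: fun_eq_iff restrict_def PiE_def extensional_def)
    show "\<forall>v\<in>(B - {j}) \<rightarrow>\<^sub>E K. restrict (v(j := v i)) (B - {j}) = v"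
      using assms by (auto simp: fun_eq_iff restrict_def PiE_def extensional_def)
    show "(\<lambda>w. restrict w (B - {j})) ` {w \<in> B \<rightarrow>\<^sub>E K. w i = w j} \<subseteq> (B - {j}) \<rightarrow>\<^sub>E K"
      by (auto simp: PiE_def Pi_def)
    show "(\<lambda>v. v(j := v i)) ` ((B - {j}) \<rightarrow>\<^sub>E K) \<subseteq> {w \<in> B \<rightarrow>\<^sub>E K. w i = w j}"
      using assms by (auto simp: PiE_def extensional_def Pi_def)
  qed
  then have "card {w \<in> B \<rightarrow>\<^sub>E K. w i = w j} = card ((B - {j}) \<rightarrow>\<^sub>E K)"
    by (rule bij_betw_same_card)
  also have "\<dots> = card K ^ (card B - 1)"
    using assms by (simp add: card_PiE)
  finally show ?thesis .
qed

text \<open>Swapping the letters at \<open>i\<close> and \<open>j\<close> exchanges the words with \<open>w i > w j\<close> and those with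
  \<open>w i < w j\<close>, so twice the former plus the words with \<open>w i = w j\<close> is everything. The additive
  form keeps the identity within the natural numbers.\<close>

lemma card_words_descent:
  fixes B :: "'a set" and K :: "'b::linorder set"
  assumes "finite B" "finite K" "i \<in> B" "j \<in> B"
  shows "2 * card {w \<in> B \<rightarrow>\<^sub>E K. w i > w j} + card {w \<in> B \<rightarrow>\<^sub>E K. w i = w j}
    = card K ^ card B"
proof -
  let ?G = "{w \<in> B \<rightarrow>\<^sub>E K. w i > w j}"
  let ?L = "{w \<in> B \<rightarrow>\<^sub>E K. w i < w j}"
  let ?E = "{w \<in> B \<rightarrow>\<^sub>E K. w i = w j}"
  have fin: "finite (B \<rightarrow>\<^sub>E K)"
    using assms by (simp add: finite_PiE)
  have "bij_betw (\<lambda>w. w(i := w j, j := w i)) ?G ?L"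
    by (rule bij_betw_byWitness[where f' = "\<lambda>w. w(i := w j, j := w i)"])
      (use assms in \<open>auto simp: fun_eq_iff PiE_def extensional_def Pi_def\<close>)
  then have GL: "card ?L = card ?G"
    by (simp add: bij_betw_same_card)
  have "B \<rightarrow>\<^sub>E K = ?G \<union> ?L \<union> ?E"
    by auto
  then have "card (B \<rightarrow>\<^sub>E K) = card (?G \<union> ?L \<union> ?E)"
    by simp
  also have "\<dots> = card ?G + card ?L + card ?E"
    using fin by (subst card_Un_disjoint; (subst card_Un_disjoint)?) auto
  finally show ?thesis
    using GL assms by (simp add: card_PiE)
qed

text \<open>Double counting of the incident pairs of \<open>W\<close> and \<open>P\<close>.\<close>

lemma sum_card_exchange:
  assumes "finite W" "finite P"
  shows "(\<Sum>w\<in>W. card {p \<in> P. R w p}) = (\<Sum>p\<in>P. card {w \<in> W. R w p})"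
proof -
  have "(\<Sum>w\<in>W. card {p \<in> P. R w p}) = (\<Sum>w\<in>W. \<Sum>p\<in>P. if R w p then 1 else 0)"
    using assms by (simp add: sum.If_cases Int_def)
  also have "\<dots> = (\<Sum>p\<in>P. \<Sum>w\<in>W. if R w p then 1 else 0)"
    by (rule sum.swap)
  finally show ?thesis
    using assms by (simp add: sum.If_cases Int_def)
qed

section \<open>Neighbouring cells on the torus\<close>

definition torus_step :: "(nat \<Rightarrow> nat) \<Rightarrow> (nat \<Rightarrow> nat) \<Rightarrow> nat \<Rightarrow> nat \<Rightarrow> nat" where
  "torus_step m i l = i(l := if i l = m l then 1 else i l + 1)"

definition torus_edges :: "nat \<Rightarrow> (nat \<Rightarrow> nat) \<Rightarrow> ((nat \<Rightarrow> nat) \<times> (nat \<Rightarrow> nat)) set" where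
  "torus_edges d m = (\<lambda>(i, l). (i, torus_step m i l)) ` (index_box d m \<times> {1..d})"

lemma finite_index_box: "finite (index_box d m)"
  by (simp add: index_box_def finite_PiE)

lemma card_index_box: "card (index_box d m) = (\<Prod>l\<in>{1..d}. m l)"
  by (simp add: index_box_def card_PiE)

lemma finite_torus_edges: "finite (torus_edges d m)"
  by (simp add: torus_edges_def finite_index_box)

lemma torus_step_in_box:
  assumes "i \<in> index_box d m" "l \<in> {1..d}"
  shows "torus_step m i l \<in> index_box d m"
  using assms
  by (fastforce simp: torus_step_def index_box_def PiE_def Pi_def extensional_def
      intro: le_neq_implies_less Suc_leI)

lemma index_box_eqI:
  assumes "i \<in> index_box d m" "j \<in> index_box d m" "\<And>r. r \<in> {1..d} \<Longrightarrow> i r = j r"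
  shows "i = j"
  using assms unfolding index_box_def by (rule PiE_ext)

text \<open>A side of length \<open>1\<close> would make the step in its direction a loop.\<close>

lemma torus_step_changes:
  assumes "m l \<ge> 2"
  shows "torus_step m i l l \<noteq> i l"
  using assms by (auto simp: torus_step_def)

lemma torus_edges_distinct:
  assumes "\<forall>l\<in>{1..d}. m l \<ge> 2" "(i, j) \<in> torus_edges d m"
  shows "i \<in> index_box d m" "j \<in> index_box d m" "i \<noteq> j"
proof -
  obtain l where "l \<in> {1..d}" "i \<in> index_box d m" "j = torus_step m i l"
    using assms(2) by (auto simp: torus_edges_def)
  then show "i \<in> index_box d m" "j \<in> index_box d m" "i \<noteq> j"
    using assms(1) torus_step_in_box torus_step_changes[of m l i] by auto
qed

text \<open>A step changes only the coordinate \<open>l\<close>, so its end points reveal its direction.\<close>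

lemma card_torus_edges:
  assumes "\<forall>l\<in>{1..d}. m l \<ge> 2"
  shows "card (torus_edges d m) = d * (\<Prod>l\<in>{1..d}. m l)"
proof -
  have "l = l'" if "torus_step m i l = torus_step m i l'" "l \<in> {1..d}" for i l l'
  proof (rule ccontr)
    assume "l \<noteq> l'"
    then have "torus_step m i l' l = i l"
      by (simp add: torus_step_def)
    with that assms torus_step_changes[of m l i] show False
      by auto
  qed
  then have "inj_on (\<lambda>(i, l). (i, torus_step m i l)) (index_box d m \<times> {1..d})"
    by (auto simp: inj_on_def)
  then show ?thesis
    by (simp add: torus_edges_def card_image card_cartesian_product card_index_box)
qed

lemma successor_iff_torus_step:
  assumes "i \<in> index_box d m" "j \<in> index_box d m"
  shows "successor d i j \<longleftrightarrow> (\<exists>l\<in>{1..d}. i l \<noteq> m l \<and> j = torus_step m i l)"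
proof
  assume "successor d i j"
  then obtain l where l: "l \<in> {1..d}" "\<forall>r\<in>{1..d}. j r = i r + (if r = l then 1 else 0)"
    by (auto simp: successor_def)
  then have "j l = i l + 1"
    by auto
  moreover have "j l \<le> m l"
    using assms(2) l(1) unfolding index_box_def by (metis PiE_mem atLeastAtMost_iff)
  ultimately have ne: "i l \<noteq> m l"
    by simp
  have "j = torus_step m i l"
    by (rule index_box_eqI[OF assms(2) torus_step_in_box[OF assms(1) l(1)]])
      (use l ne in \<open>auto simp: torus_step_def\<close>)
  with l ne show "\<exists>l\<in>{1..d}. i l \<noteq> m l \<and> j = torus_step m i l"
    by blast
next
  assume "\<exists>l\<in>{1..d}. i l \<noteq> m l \<and> j = torus_step m i l"
  then show "successor d i j"
    by (auto simp: successor_def torus_step_def)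
qed

text \<open>The direction is unique because a second one \<open>l'\<close> would leave coordinate \<open>l\<close> unchanged,
  although it goes from \<open>m l\<close> to \<open>1\<close>.\<close>

lemma cyclic_successor_iff_torus_step:
  assumes m: "\<forall>l\<in>{1..d}. m l \<ge> 2"
    and ij: "i \<in> index_box d m" "j \<in> index_box d m"
  shows "cyclic_successor d m i j \<longleftrightarrow> (\<exists>l\<in>{1..d}. i l = m l \<and> j = torus_step m i l)"
proof
  assume "cyclic_successor d m i j"
  then obtain l where l: "l \<in> {1..d}" "i l = m l" "j l = 1" "\<forall>r\<in>{1..d} - {l}. i r = j r"
    by (auto simp: cyclic_successor_def)
  have "j = torus_step m i l"
    by (rule index_box_eqI[OF ij(2) torus_step_in_box[OF ij(1) l(1)]])
      (use l in \<open>auto simp: torus_step_def\<close>)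
  with l show "\<exists>l\<in>{1..d}. i l = m l \<and> j = torus_step m i l"
    by blast
next
  assume "\<exists>l\<in>{1..d}. i l = m l \<and> j = torus_step m i l"
  then obtain l where l: "l \<in> {1..d}" "i l = m l" "j = i(l := 1)"
    by (auto simp: torus_step_def)
  show "cyclic_successor d m i j"
    unfolding cyclic_successor_def
  proof (rule ex1I[of _ l])
    show "l \<in> {1..d} \<and> i l = m l \<and> j l = 1 \<and> (\<forall>r\<in>{1..d} - {l}. i r = j r)"
      using l by auto
  next
    fix l'
    assume l': "l' \<in> {1..d} \<and> i l' = m l' \<and> j l' = 1 \<and> (\<forall>r\<in>{1..d} - {l'}. i r = j r)"
    show "l' = l"
    proof (rule ccontr)
      assume "l' \<noteq> l"
      then have "i l = j l"
        using l' l(1) by auto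
      moreover have "m l \<ge> 2"
        using m l(1) by blast
      ultimately show False
        using l by simp
    qed
  qed
qed

lemma torus_edges_iff:
  assumes "\<forall>l\<in>{1..d}. m l \<ge> 2"
  shows "(i, j) \<in> torus_edges d m \<longleftrightarrow>
    i \<in> index_box d m \<and> j \<in> index_box d m \<and> (successor d i j \<or> cyclic_successor d m i j)"
proof
  assume edge: "(i, j) \<in> torus_edges d m"
  then obtain l where "l \<in> {1..d}" "j = torus_step m i l"
    by (auto simp: torus_edges_def)
  then show "i \<in> index_box d m \<and> j \<in> index_box d m \<and>
      (successor d i j \<or> cyclic_successor d m i j)"
    using torus_edges_distinct(1,2)[OF assms edge]
      successor_iff_torus_step cyclic_successor_iff_torus_step[OF assms] by blast
next
  assume R: "i \<in> index_box d m \<and> j \<in> index_box d m \<and>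
      (successor d i j \<or> cyclic_successor d m i j)"
  then have "\<exists>l\<in>{1..d}. j = torus_step m i l"
    using successor_iff_torus_step cyclic_successor_iff_torus_step[OF assms] by blast
  with R show "(i, j) \<in> torus_edges d m"
    by (auto simp: torus_edges_def)
qed

text \<open>An ordinary step increases some coordinate, while a wrap-around step decreases its own and
  keeps the others.\<close>

lemma not_successor_and_cyclic_successor:
  assumes m: "\<forall>l\<in>{1..d}. m l \<ge> 2"
    and "successor d i j" "cyclic_successor d m i j"
  shows False
proof -
  obtain l where l: "l \<in> {1..d}" "j l = i l + 1"
    using assms(2) by (auto simp: successor_def)
  obtain l' where l': "l' \<in> {1..d}" "i l' = m l'" "j l' = 1" "\<forall>r\<in>{1..d} - {l'}. i r = j r"
    using assms(3) by (auto simp: cyclic_successor_def)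
  show False
  proof (cases "l = l'")
    case True
    moreover have "m l' \<ge> 2"
      using m l'(1) by blast
    ultimately show False
      using l l' by simp
  next
    case False
    then have "i l = j l"
      using l(1) l'(4) by auto
    with l show False
      by simp
  qed
qed

lemma cycdes_eq_card_torus_edges:
  assumes "\<forall>l\<in>{1..d}. m l \<ge> 2"
  shows "cycdes d m w = card {(i, j) \<in> torus_edges d m. w i > w j}"
proof -
  have "{(i, j) \<in> torus_edges d m. w i > w j} = descents d m w \<union> cyclic_descents d m w"
    using torus_edges_iff[OF assms] by (auto simp: descents_def cyclic_descents_def)
  moreover have "descents d m w \<inter> cyclic_descents d m w = {}"
    using not_successor_and_cyclic_successor[OF assms]
    by (auto simp: descents_def cyclic_descents_def)
  moreover have "finite (descents d m w)" "finite (cyclic_descents d m w)"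
    by (rule finite_subset[of _ "index_box d m \<times> index_box d m"];
        auto simp: descents_def cyclic_descents_def finite_index_box)+
  ultimately show ?thesis
    by (simp add: cycdes_def card_Un_disjoint)
qed

lemma cyclev_eq_card_torus_edges:
  assumes "\<forall>l\<in>{1..d}. m l \<ge> 2"
  shows "cyclev d m w = card {(i, j) \<in> torus_edges d m. w i = w j}"
proof -
  have "{(i, j) \<in> torus_edges d m. w i = w j} = levels d m w \<union> cyclic_levels d m w"
    using torus_edges_iff[OF assms] by (auto simp: levels_def cyclic_levels_def)
  moreover have "levels d m w \<inter> cyclic_levels d m w = {}"
    using not_successor_and_cyclic_successor[OF assms]
    by (auto simp: levels_def cyclic_levels_def)
  moreover have "finite (levels d m w)" "finite (cyclic_levels d m w)"
    by (rule finite_subset[of _ "index_box d m \<times> index_box d m"];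
        auto simp: levels_def cyclic_levels_def finite_index_box)+
  ultimately show ?thesis
    by (simp add: cyclev_def card_Un_disjoint)
qed

section \<open>The totals\<close>

lemma finite_tensor_words: "finite (tensor_words d m k)"
  by (simp add: tensor_words_def finite_PiE finite_index_box)

lemma total_cycdes_eq_sum:
  assumes "\<forall>l\<in>{1..d}. m l \<ge> 2"
  shows "total_cycdes d m k =
    (\<Sum>(i, j)\<in>torus_edges d m. card {w \<in> tensor_words d m k. w i > w j})"
  using sum_card_exchange[OF finite_tensor_words[of d m k] finite_torus_edges[of d m],
      where R = "\<lambda>w (i, j). w i > w j"]
  by (simp add: total_cycdes_def cycdes_eq_card_torus_edges[OF assms] case_prod_unfold)

lemma total_cyclev_eq_sum:
  assumes "\<forall>l\<in>{1..d}. m l \<ge> 2"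
  shows "total_cyclev d m k =
    (\<Sum>(i, j)\<in>torus_edges d m. card {w \<in> tensor_words d m k. w i = w j})"
  using sum_card_exchange[OF finite_tensor_words[of d m k] finite_torus_edges[of d m],
      where R = "\<lambda>w (i, j). w i = w j"]
  by (simp add: total_cyclev_def cyclev_eq_card_torus_edges[OF assms] case_prod_unfold)

lemma total_cyclev_closed_form:
  assumes "\<forall>l\<in>{1..d}. m l \<ge> 2"
  shows "total_cyclev d m k = d * (\<Prod>l\<in>{1..d}. m l) * k ^ ((\<Prod>l\<in>{1..d}. m l) - 1)"
proof -
  have "total_cyclev d m k = (\<Sum>p\<in>torus_edges d m. k ^ ((\<Prod>l\<in>{1..d}. m l) - 1))"
    unfolding total_cyclev_eq_sum[OF assms]
  proof (rule sum.cong[OF refl], clarify)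
    fix i j
    assume "(i, j) \<in> torus_edges d m"
    from card_words_level[OF finite_index_box torus_edges_distinct[OF assms this], of "{1..k}"]
    show "card {w \<in> tensor_words d m k. w i = w j} = k ^ ((\<Prod>l\<in>{1..d}. m l) - 1)"
      by (simp add: tensor_words_def card_index_box)
  qed
  then show ?thesis
    by (simp add: card_torus_edges[OF assms])
qed

text \<open>The identity of \<open>card_words_descent\<close> holds on every edge, so summing it over the edges
  determines the number of descents from the number of levels.\<close>

lemma total_cycdes_cyclev:
  assumes "\<forall>l\<in>{1..d}. m l \<ge> 2"
  shows "2 * total_cycdes d m k + total_cyclev d m k
    = d * (\<Prod>l\<in>{1..d}. m l) * k ^ (\<Prod>l\<in>{1..d}. m l)"
proof -
  have "2 * total_cycdes d m k + total_cyclev d m k =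
      (\<Sum>(i, j)\<in>torus_edges d m. 2 * card {w \<in> tensor_words d m k. w i > w j}
        + card {w \<in> tensor_words d m k. w i = w j})"
    by (simp add: total_cycdes_eq_sum[OF assms] total_cyclev_eq_sum[OF assms]
        sum_distrib_left sum.distrib case_prod_unfold)
  also have "\<dots> = (\<Sum>p\<in>torus_edges d m. k ^ (\<Prod>l\<in>{1..d}. m l))"
  proof (rule sum.cong[OF refl], clarify)
    fix i j
    assume "(i, j) \<in> torus_edges d m"
    note ij = torus_edges_distinct[OF assms this]
    from card_words_descent[OF finite_index_box finite_atLeastAtMost ij(1,2), of 1 k]
    show "2 * card {w \<in> tensor_words d m k. w i > w j} + card {w \<in> tensor_words d m k. w i = w j}
        = k ^ (\<Prod>l\<in>{1..d}. m l)"
      by (simp add: tensor_words_def card_index_box)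
  qed
  finally show ?thesis
    by (simp add: card_torus_edges[OF assms])
qed

theorem mainTheorem4:
  fixes k d :: nat and m :: "nat \<Rightarrow> nat"
  assumes "k \<ge> 1" and "d \<ge> 1" and "\<forall>l\<in>{1..d}. m l \<ge> 2"
  shows "real (total_cycdes d m k) =
           1 / 2 * (real d * (\<Prod>l\<in>{1..d}. real (m l))) * (real k - 1)
             * real k ^ ((\<Prod>l\<in>{1..d}. m l) - 1)
       \<and> (k \<noteq> 1 \<longrightarrow>
           real (total_cyclev d m k) = 2 * real (total_cycdes d m k) / (real k - 1))
       \<and> real (total_cyclev d m k) =
           (real d * (\<Prod>l\<in>{1..d}. real (m l))) * real k ^ ((\<Prod>l\<in>{1..d}. m l) - 1)"
proof -
  let ?N = "\<Prod>l\<in>{1..d}. m l"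
  let ?c = "real d * (\<Prod>l\<in>{1..d}. real (m l))"
  have "?N > 0"
    using assms(3) by (intro prod_pos) fastforce
  then have pow: "real k ^ ?N = real k * real k ^ (?N - 1)"
    by (metis power_minus_mult mult.commute)
  have lev: "real (total_cyclev d m k) = ?c * real k ^ (?N - 1)"
    by (simp add: total_cyclev_closed_form[OF assms(3)])
  have "real (2 * total_cycdes d m k + total_cyclev d m k) = ?c * real k ^ ?N"
    by (subst total_cycdes_cyclev[OF assms(3)]) simp
  then have "2 * real (total_cycdes d m k) = ?c * (real k * real k ^ (?N - 1)) - ?c * real k ^ (?N - 1)"
    using lev pow by simp
  then have des: "2 * real (total_cycdes d m k) = ?c * (real k - 1) * real k ^ (?N - 1)"
    by (simp add: algebra_simps)
  then have "real (total_cyclev d m k) = 2 * real (total_cycdes d m k) / (real k - 1)"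
    if "k \<noteq> 1"
    unfolding des lev using that by simp
  with des lev show ?thesis
    by simp
qed

end
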